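(* For each $N$ let $(X_n)_{0\le n\le N}$ be the edge-counting process of the growing random graph with $N$ vertices, and let $\sigma_n^2:=\mathrm{Var}[X_n]$. Let $$\psi(t)=(1-t)\left\{(2-t)L^2+2(3-t)L+t(6-t)\right\},\quad L:=\log(1-t),\quad t\in[0,1),\qquad \psi(1)=0.$$ Then $$\max_{1\le n\le N}\left|N^{-3}\sigma_n^2-\psi(n/N)\right|\to 0\quad\text{as }N\to\infty,$$ and for every $\delta\in(0,1)$ the approximation error is $O(N^{-1})$ in the range $n/N<1-\delta$, i.e. $\max_{1\le n<(1-\delta)N}\left|N^{-3}\sigma_n^2-\psi(n/N)\right|=O(N^{-1})$ as $N\to\infty$.
   Context: Growing random graph. Fix $N$. Initially there is a pool of $N$ virtual vertices and no edges. At each step, an element is selected uniformly at random from the current pool of virtual elements (vertices and edges), removed from the pool, and declared occupied. When the $n$-th vertex becomes occupied (it is then labelled $n$), the $n-1$ edges linking it to the previously occupied vertices $1,\dots,n-1$ are added to the pool as virtual edges. Thus when there are $n$ occupied vertices and $k$ occupied edges, the pool consists of $N-n$ virtual vertices and $\binom n2-k$ virtual edges. The process continues until the pool is empty (complete graph on $N$ vertices). For $1\le n\le N$, $X_n$ is the number of occupied edges at the moment the $n$-th vertex becomes occupied; $X_0=0$. The law of $(X_n)$, and hence $\sigma_n^2$, depends on $N$. Equivalently, $(X_n)$ is a Markov chain with $X_0=X_1=0$ such that, for $1\le n<N$, given $X_n=k$, the increment $X_{n+1}-X_n$ is the number of black balls drawn before the first white ball when sampling uniformly without replacement from an urn with $\binom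 n2-k$ black and $N-n$ white balls. *)

theory Defs
  imports "HOL-Probability.Probability" "HOL-Library.Landau_Symbols"
begin

text \<open>
  A history is the list of the elements occupied so far, in order of occupation. Vertices carry
  names from \<open>{1..N}\<close> that merely identify the members of the initial pool; the paper's label of an
  occupied vertex is its rank among the vertices of the history. Edges are two-element sets of
  occupied vertices.
\<close>

datatype element = Vertex nat | Edge "nat set"

definition is_vertex :: "element \<Rightarrow> bool" where
  "is_vertex x \<longleftrightarrow> (\<exists>v. x = Vertex v)"

definition is_edge :: "element \<Rightarrow> bool" where
  "is_edge x \<longleftrightarrow> (\<exists>e. x = Edge e)"

definition num_vertices :: "element list \<Rightarrow> nat" where
  "num_vertices h = length (filter is_vertex h)"

definition num_edges :: "element list \<Rightarrow> nat" where
  "num_edges h = length (filter is_edge h)"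

definition pool :: "nat \<Rightarrow> element list \<Rightarrow> element set" where
  "pool N h =
     (Vertex ` {1..N} \<union> {Edge {u, v} |u v. u \<noteq> v \<and> Vertex u \<in> set h \<and> Vertex v \<in> set h}) - set h"

definition growth_step :: "nat \<Rightarrow> element list \<Rightarrow> element list pmf" where
  "growth_step N h =
     (if pool N h = {} then return_pmf h
      else map_pmf (\<lambda>x. h @ [x]) (pmf_of_set (pool N h)))"

primrec growth :: "nat \<Rightarrow> nat \<Rightarrow> element list pmf" where
  "growth N 0 = return_pmf []"
| "growth N (Suc m) = bind_pmf (growth N m) (growth_step N)"

text \<open>
  The complete process: there are \<open>N + (N choose 2)\<close> elements in total, and the pool is empty after
  exactly that many steps (lemmas \<open>growing_graph_pool_empty\<close> and \<open>growth_pool_nonempty\<close> below).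
\<close>

definition growing_graph :: "nat \<Rightarrow> element list pmf" where
  "growing_graph N = growth N (N + (N choose 2))"

definition vertex_time :: "nat \<Rightarrow> element list \<Rightarrow> nat" where
  "vertex_time n h = (LEAST m. num_vertices (take m h) = n)"

definition edge_count :: "nat \<Rightarrow> element list \<Rightarrow> nat" where
  "edge_count n h = num_edges (take (vertex_time n h) h)"

definition sigma2 :: "nat \<Rightarrow> nat \<Rightarrow> real" where
  "sigma2 N n = measure_pmf.variance (growing_graph N) (\<lambda>h. real (edge_count n h))"

definition psi :: "real \<Rightarrow> real" where
  "psi t =
     (if t = 1 then 0
      else (let L = ln (1 - t) in (1 - t) * ((2 - t) * L\<^sup>2 + 2 * (3 - t) * L + t * (6 - t))))"

definition all_elements :: "nat \<Rightarrow> element set" where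
  "all_elements N = Vertex ` {1..N} \<union> Edge ` {e. e \<subseteq> {1..N} \<and> card e = 2}"

lemma finite_all_elements: "finite (all_elements N)"
proof -
  have "finite {e. e \<subseteq> {1..N} \<and> card e = 2}"
    by (rule finite_subset[of _ "Pow {1..N}"]) auto
  then show ?thesis by (simp add: all_elements_def)
qed

lemma card_all_elements: "card (all_elements N) = N + (N choose 2)"
proof -
  have fin: "finite {e. e \<subseteq> {1..N} \<and> card e = 2}"
    by (rule finite_subset[of _ "Pow {1..N}"]) auto
  have "card (all_elements N) =
      card (Vertex ` {1..N}) + card (Edge ` {e. e \<subseteq> {1..N} \<and> card e = 2})"
    unfolding all_elements_def by (rule card_Un_disjoint) (use fin in auto)
  also have "card (Vertex ` {1..N}) = N"
    by (simp add: card_image inj_on_def)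
  also have "card (Edge ` {e. e \<subseteq> {1..N} \<and> card e = 2}) = card {e. e \<subseteq> {1..N} \<and> card e = 2}"
    by (simp add: card_image inj_on_def)
  also have "\<dots> = N choose 2"
    by (simp add: n_subsets)
  finally show ?thesis .
qed

lemma pool_subset:
  assumes "set h \<subseteq> all_elements N"
  shows "pool N h \<subseteq> all_elements N - set h"
proof
  fix x
  assume x: "x \<in> pool N h"
  then have "x \<notin> set h"
    by (simp add: pool_def)
  moreover have "x \<in> all_elements N"
  proof (cases x)
    case (Vertex v)
    with x show ?thesis by (auto simp: pool_def all_elements_def)
  next
    case (Edge e)
    with x obtain u v where uv: "e = {u, v}" "u \<noteq> v" "Vertex u \<in> set h" "Vertex v \<in> set h"
      by (auto simp: pool_def)
    then have "Vertex u \<in> all_elements N" "Vertex v \<in> all_elements N"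
      using assms by blast+
    then have "u \<in> {1..N}" "v \<in> {1..N}"
      by (auto simp: all_elements_def)
    then have "e \<subseteq> {1..N}" "card e = 2"
      using uv(1,2) by simp_all
    then show ?thesis
      using Edge by (simp add: all_elements_def)
  qed
  ultimately show "x \<in> all_elements N - set h" by simp
qed

lemma pool_empty_iff:
  assumes "set h \<subseteq> all_elements N"
  shows "pool N h = {} \<longleftrightarrow> set h = all_elements N"
proof
  assume *: "pool N h = {}"
  have V: "Vertex v \<in> set h" if "v \<in> {1..N}" for v
    using * that unfolding pool_def by blast
  have "Edge e \<in> set h" if "e \<subseteq> {1..N}" "card e = 2" for e
  proof -
    from that(2) obtain u v where e: "e = {u, v}" "u \<noteq> v"
      unfolding card_2_iff by blast
    then have "Vertex u \<in> set h" "Vertex v \<in> set h"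
      using V that(1) by blast+
    then show ?thesis
      using * e unfolding pool_def by blast
  qed
  with V have "all_elements N \<subseteq> set h"
    unfolding all_elements_def by blast
  with assms show "set h = all_elements N" by simp
next
  assume "set h = all_elements N"
  then show "pool N h = {}"
    using pool_subset[OF assms] by blast
qed

lemma finite_pool: "set h \<subseteq> all_elements N \<Longrightarrow> finite (pool N h)"
  using pool_subset finite_all_elements by (meson finite_Diff finite_subset)

lemma pool_empty_iff_length:
  assumes "set h \<subseteq> all_elements N" "distinct h"
  shows "pool N h = {} \<longleftrightarrow> length h = N + (N choose 2)"
proof -
  have "set h = all_elements N \<longleftrightarrow> card (set h) = card (all_elements N)"
    using card_subset_eq[OF finite_all_elements assms(1)] by auto
  then show ?thesis
    by (simp add: pool_empty_iff[OF assms(1)] card_all_elements distinct_card[OF assms(2)])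
qed

lemma growth_support:
  assumes "m \<le> N + (N choose 2)" "h \<in> set_pmf (growth N m)"
  shows "set h \<subseteq> all_elements N \<and> distinct h \<and> length h = m"
  using assms
proof (induction m arbitrary: h)
  case 0
  then show ?case by simp
next
  case (Suc m)
  from Suc.prems obtain g where g: "g \<in> set_pmf (growth N m)" "h \<in> set_pmf (growth_step N g)"
    by auto
  have IH: "set g \<subseteq> all_elements N" "distinct g" "length g = m"
    using Suc.IH[OF _ g(1)] Suc.prems(1) by auto
  have ne: "pool N g \<noteq> {}"
    using pool_empty_iff_length[OF IH(1,2)] IH(3) Suc.prems(1) by auto
  obtain x where "x \<in> pool N g" "h = g @ [x]"
    using g(2) ne finite_pool[OF IH(1)] by (auto simp: growth_step_def)
  then show ?case
    using IH pool_subset[OF IH(1)] by auto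
qed

lemma growth_pool_nonempty:
  assumes "m < N + (N choose 2)" "h \<in> set_pmf (growth N m)"
  shows "pool N h \<noteq> {}"
  using growth_support[of m N h] pool_empty_iff_length[of h N] assms by auto

lemma growing_graph_pool_empty:
  assumes "h \<in> set_pmf (growing_graph N)"
  shows "pool N h = {}"
  using growth_support[OF order.refl, of h N] pool_empty_iff_length[of h N] assms
  by (auto simp: growing_graph_def)

end

(*
Let Y be the number of virtual edges when the n-th vertex becomes occupied, so that Y and X_n have
the same variance. In the step-by-step process, with i occupied vertices, y virtual edges and
W = N - i, the functions y / (W + 1) and y (y - 1) / ((W + 1) (W + 2)) become martingales after
subtracting explicit terms of lower order in y. Stopping at the n-th vertex gives the first two
factorial moments of Y, and their combination simplifies to
  sigma_n^2 = (N - n + 1) (N - n + 2) sum_(m < n) (a_m^2 + a_m) / ((N - m + 1) (N - m + 2)),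
where a_m = sum_(j < m) j / (N - j). Since a_m / N is within 1 / (N - m) of -log(1 - m/N) - m/N,
the sum is a Riemann sum, with error O(1/N) away from t = 1, of
  psi(t) / (1 - t)^2 = integral over [0, t] of ((s + log(1 - s)) / (1 - s))^2 ds.
Near t = 1 both sides are small: with x = (N - n + 1) / N, monotonicity of a_m and a telescoping
sum give sigma_n^2 / N^3 <= x (log^2 x - log x).
*)
theory Submission
  imports Defs "HOL-Real_Asymp.Real_Asymp"
begin

section \<open>The stopped martingales\<close>

lemma num_vertices_append: "num_vertices (xs @ ys) = num_vertices xs + num_vertices ys"
  by (simp add: num_vertices_def)

lemma num_vertices_take_le: "num_vertices (take m h) \<le> num_vertices h"
  by (metis append_take_drop_id le_add1 num_vertices_append)

text \<open>A discrete intermediate value argument: one more entry raises the number of vertices by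
  at most one.\<close>

lemma exists_vertex_time:
  assumes "n \<le> num_vertices h"
  shows "\<exists>m \<le> length h. num_vertices (take m h) = n"
  using assms
proof (induction h rule: rev_induct)
  case Nil
  then show ?case by (simp add: num_vertices_def)
next
  case (snoc x h)
  show ?case
  proof (cases "n \<le> num_vertices h")
    case True
    with snoc.IH obtain m where "m \<le> length h" "num_vertices (take m h) = n" by blast
    then show ?thesis by (intro exI[of _ m]) simp
  next
    case False
    have "num_vertices (h @ [x]) \<le> Suc (num_vertices h)"
      by (simp add: num_vertices_def)
    with False snoc.prems have "num_vertices (h @ [x]) = n" by linarith
    then show ?thesis by (intro exI[of _ "length (h @ [x])"]) simp
  qed
qed

text \<open>The least prefix with n vertices already lies inside \<open>h\<close>, so later entries
  cannot change it. This is what freezes a process at the n-th vertex.\<close>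

lemma edge_count_append:
  assumes "n \<le> num_vertices h"
  shows "edge_count n (h @ xs) = edge_count n h"
proof -
  obtain m0 where m0: "m0 \<le> length h" "num_vertices (take m0 h) = n"
    using exists_vertex_time[OF assms] by blast
  have P: "num_vertices (take (vertex_time n h) h) = n"
    unfolding vertex_time_def by (rule LeastI[where P = "\<lambda>m. num_vertices (take m h) = n"], fact m0(2))
  have le: "vertex_time n h \<le> length h"
    using Least_le[of "\<lambda>m. num_vertices (take m h) = n", OF m0(2)] m0(1)
    by (simp add: vertex_time_def)
  have "vertex_time n (h @ xs) = vertex_time n h"
    unfolding vertex_time_def[of n "h @ xs"]
  proof (rule Least_equality)
    show "num_vertices (take (vertex_time n h) (h @ xs)) = n"
      using le P by simp
  next
    fix y
    assume y: "num_vertices (take y (h @ xs)) = n"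
    show "vertex_time n h \<le> y"
    proof (cases "y \<le> length h")
      case True
      with y show ?thesis by (simp add: vertex_time_def Least_le)
    next
      case False
      with le show ?thesis by simp
    qed
  qed
  with le show ?thesis by (simp add: edge_count_def)
qed

lemma edge_count_snoc_vertex:
  assumes "Suc (num_vertices h) = n"
  shows "edge_count n (h @ [Vertex v]) = num_edges h"
proof -
  have "vertex_time n (h @ [Vertex v]) = Suc (length h)"
    unfolding vertex_time_def
  proof (rule Least_equality)
    show "num_vertices (take (Suc (length h)) (h @ [Vertex v])) = n"
      using assms by (simp add: num_vertices_def is_vertex_def)
  next
    fix y
    assume y: "num_vertices (take y (h @ [Vertex v])) = n"
    show "Suc (length h) \<le> y"
    proof (rule ccontr)
      assume "\<not> Suc (length h) \<le> y"
      then have "num_vertices (take y (h @ [Vertex v])) = num_vertices (take y h)" by simp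
      with y num_vertices_take_le[of y h] assms show False by simp
    qed
  qed
  then show ?thesis
    by (simp add: edge_count_def num_edges_def is_edge_def)
qed

section \<open>Composition of the pool\<close>

text \<open>The invariant of the growth process. Its last conjunct places the occupied edges among
  the pairs of occupied vertices, so that virtual edges can be counted by subtraction.\<close>

definition closed_history :: "nat \<Rightarrow> element list \<Rightarrow> bool" where
  "closed_history N h \<longleftrightarrow> set h \<subseteq> all_elements N \<and> distinct h \<and>
     (\<forall>e v. Edge e \<in> set h \<longrightarrow> v \<in> e \<longrightarrow> Vertex v \<in> set h)"

lemma num_vertices_eq_card:
  assumes "distinct h"
  shows "num_vertices h = card {v. Vertex v \<in> set h}"
proof -
  have "num_vertices h = card (set (filter is_vertex h))"
    unfolding num_vertices_def by (rule distinct_card[symmetric]) (simp add: assms)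
  also have "set (filter is_vertex h) = Vertex ` {v. Vertex v \<in> set h}"
    by (auto simp: is_vertex_def)
  finally show ?thesis by (simp add: card_image inj_on_def)
qed

lemma num_edges_eq_card:
  assumes "distinct h"
  shows "num_edges h = card {e. Edge e \<in> set h}"
proof -
  have "num_edges h = card (set (filter is_edge h))"
    unfolding num_edges_def by (rule distinct_card[symmetric]) (simp add: assms)
  also have "set (filter is_edge h) = Edge ` {e. Edge e \<in> set h}"
    by (auto simp: is_edge_def)
  finally show ?thesis by (simp add: card_image inj_on_def)
qed

lemma finite_occupied_vertices: "finite {v. Vertex v \<in> set h}"
  using finite_vimageI[of "set h" Vertex] by (simp add: vimage_def inj_def)

lemma finite_occupied_edges: "finite {e. Edge e \<in> set h}"
  using finite_vimageI[of "set h" Edge] by (simp add: vimage_def inj_def)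

lemma pool_decomp:
  "pool N h = Vertex ` ({1..N} - {v. Vertex v \<in> set h}) \<union>
     Edge ` ({e. e \<subseteq> {v. Vertex v \<in> set h} \<and> card e = 2} - {e. Edge e \<in> set h})"
  unfolding pool_def card_2_iff by fastforce

lemma card_virtual_vertices:
  assumes "closed_history N h"
  shows "real (card ({1..N} - {v. Vertex v \<in> set h})) = real N - real (num_vertices h)"
    and "num_vertices h \<le> N"
proof -
  have sub: "{v. Vertex v \<in> set h} \<subseteq> {1..N}"
    using assms by (auto simp: closed_history_def all_elements_def)
  have nv: "num_vertices h = card {v. Vertex v \<in> set h}"
    using assms by (simp add: closed_history_def num_vertices_eq_card)
  show le: "num_vertices h \<le> N"
    using card_mono[OF _ sub] nv by simp
  show "real (card ({1..N} - {v. Vertex v \<in> set h})) = real N - real (num_vertices h)"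
    using card_Diff_subset[OF finite_occupied_vertices sub] nv le by (simp add: of_nat_diff)
qed

lemma card_virtual_edges:
  assumes "closed_history N h"
  shows "real (card ({e. e \<subseteq> {v. Vertex v \<in> set h} \<and> card e = 2} - {e. Edge e \<in> set h}))
    = real (num_vertices h choose 2) - real (num_edges h)"
proof -
  let ?V = "{v. Vertex v \<in> set h}"
  let ?P = "{e. e \<subseteq> ?V \<and> card e = 2}"
  have fin: "finite ?P"
    by (rule finite_subset[of _ "Pow ?V"]) (auto simp: finite_occupied_vertices)
  have sub: "{e. Edge e \<in> set h} \<subseteq> ?P"
    using assms by (auto simp: closed_history_def all_elements_def)
  have "card ?P = num_vertices h choose 2"
    using assms n_subsets[OF finite_occupied_vertices, of h 2]
    by (simp add: closed_history_def num_vertices_eq_card)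
  moreover have "num_edges h = card {e. Edge e \<in> set h}"
    using assms by (simp add: closed_history_def num_edges_eq_card)
  ultimately show ?thesis
    using card_Diff_subset[OF finite_occupied_edges sub] card_mono[OF fin sub]
    by (simp add: of_nat_diff)
qed

text \<open>Reduction to the Markov chain: if a function on the pool distinguishes only vertices
  from edges, its sum depends on the history only through the two counts.\<close>

lemma sum_pool:
  fixes f :: "element \<Rightarrow> real"
  assumes "closed_history N h"
    and "\<And>v. v \<in> {1..N} \<Longrightarrow> f (Vertex v) = a" and "\<And>e. f (Edge e) = b"
  shows "sum f (pool N h) = (real N - real (num_vertices h)) * a
    + (real (num_vertices h choose 2) - real (num_edges h)) * b"
proof -
  let ?V = "{1..N} - {v. Vertex v \<in> set h}"
  let ?E = "{e. e \<subseteq> {v. Vertex v \<in> set h} \<and> card e = 2} - {e. Edge e \<in> set h}"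
  have "finite (pool N h)"
    using assms(1) by (simp add: closed_history_def finite_pool)
  then have "finite (Vertex ` ?V)" "finite (Edge ` ?E)"
    unfolding pool_decomp by (rule finite_subset[rotated]; blast)+
  then have "sum f (pool N h) = sum f (Vertex ` ?V) + sum f (Edge ` ?E)"
    unfolding pool_decomp by (intro sum.union_disjoint) auto
  also have "sum f (Vertex ` ?V) = (\<Sum>v\<in>?V. f (Vertex v))"
    by (subst sum.reindex) (auto simp: inj_on_def)
  also have "\<dots> = (\<Sum>v\<in>?V. a)"
    by (rule sum.cong) (use assms(2) in auto)
  also have "sum f (Edge ` ?E) = (\<Sum>e\<in>?E. f (Edge e))"
    by (subst sum.reindex) (auto simp: inj_on_def)
  finally show ?thesis
    by (simp only: assms(3) sum_constant card_virtual_vertices(1)[OF assms(1)]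
      card_virtual_edges[OF assms(1)])
qed

lemma closed_history_snoc:
  assumes "closed_history N h" "x \<in> pool N h"
  shows "closed_history N (h @ [x])"
proof -
  have "x \<in> all_elements N - set h"
    using assms pool_subset[of h N] by (auto simp: closed_history_def)
  moreover have "Vertex v \<in> set h" if "x = Edge e" "v \<in> e" for e v
    using assms(2) that by (auto simp: pool_def)
  ultimately show ?thesis
    using assms(1) unfolding closed_history_def by auto
qed

lemma growth_step_nonempty:
  assumes "closed_history N h" "pool N h \<noteq> {}"
  shows "set_pmf (growth_step N h) = (\<lambda>x. h @ [x]) ` pool N h"
  using assms by (simp add: growth_step_def closed_history_def finite_pool)

lemma finite_set_growth_step:
  assumes "closed_history N h"
  shows "finite (set_pmf (growth_step N h))"
  using assms by (simp add: growth_step_def closed_history_def finite_pool)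

lemma growth_closed:
  assumes "h \<in> set_pmf (growth N m)"
  shows "closed_history N h"
  using assms
proof (induction m arbitrary: h)
  case 0
  then show ?case by (simp add: closed_history_def)
next
  case (Suc m)
  from Suc.prems obtain g where g: "g \<in> set_pmf (growth N m)" "h \<in> set_pmf (growth_step N g)"
    by auto
  show ?case
  proof (cases "pool N g = {}")
    case True
    with g Suc.IH show ?thesis by (simp add: growth_step_def)
  next
    case False
    with g Suc.IH growth_step_nonempty[of N g] show ?thesis
      by (auto intro: closed_history_snoc)
  qed
qed

lemma finite_set_growth: "finite (set_pmf (growth N m))"
  by (induction m) (auto intro: finite_set_growth_step growth_closed)

text \<open>
  \<open>\<Phi> i y\<close> is evaluated at \<open>i\<close> occupied vertices and \<open>y\<close> virtual edges, and frozen when the \<open>n\<close>-th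
  vertex becomes occupied. The second branch keeps \<open>vertex_time n\<close> away from histories in which
  its \<open>LEAST\<close> ranges over the empty set.
\<close>

definition stopped :: "nat \<Rightarrow> (nat \<Rightarrow> real \<Rightarrow> real) \<Rightarrow> element list \<Rightarrow> real" where
  "stopped n \<Phi> h =
     (if num_vertices h < n
      then \<Phi> (num_vertices h) (real (num_vertices h choose 2) - real (num_edges h))
      else \<Phi> n (real (n choose 2) - real (edge_count n h)))"

section \<open>Optional stopping at the n-th vertex\<close>

text \<open>\<open>harm\<close> is the martingale equation multiplied by the pool size N - i + y.
  Each of the N - i virtual vertices brings i new edges when occupied, and each of the y virtual
  edges lowers y by one.\<close>

lemma expectation_growth_step:
  assumes h: "closed_history N h" and "n \<le> N"
    and harm: "\<And>i y. i < N \<Longrightarrow>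
      (real N - real i + y) * \<Phi> i y
        = (real N - real i) * \<Phi> (Suc i) (y + real i) + y * \<Phi> i (y - 1)"
  shows "measure_pmf.expectation (growth_step N h) (stopped n \<Phi>) = stopped n \<Phi> h"
proof (cases "pool N h = {}")
  case True
  then show ?thesis by (simp add: growth_step_def)
next
  case False
  have fin: "finite (pool N h)"
    using h by (simp add: closed_history_def finite_pool)
  have E: "measure_pmf.expectation (growth_step N h) (stopped n \<Phi>)
      = (\<Sum>x\<in>pool N h. stopped n \<Phi> (h @ [x])) / real (card (pool N h))"
    using False by (simp add: growth_step_def integral_pmf_of_set[OF False fin])
  have pos: "real (card (pool N h)) > 0"
    using False fin by (simp add: card_gt_0_iff)
  show ?thesis
  proof (cases "num_vertices h < n")
    case False
    then have "stopped n \<Phi> (h @ [x]) = stopped n \<Phi> h" for x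
      by (simp add: stopped_def num_vertices_append edge_count_append)
    with E pos show ?thesis by simp
  next
    case True
    let ?i = "num_vertices h"
    let ?y = "real (?i choose 2) - real (num_edges h)"
    have nvV: "num_vertices (h @ [Vertex v]) = Suc ?i" for v
      by (simp add: num_vertices_def is_vertex_def)
    have nvE: "num_vertices (h @ [Edge e]) = ?i" for e
      by (simp add: num_vertices_def is_vertex_def)
    have neV: "num_edges (h @ [Vertex v]) = num_edges h" for v
      by (simp add: num_edges_def is_edge_def)
    have neE: "num_edges (h @ [Edge e]) = Suc (num_edges h)" for e
      by (simp add: num_edges_def is_edge_def)
    have ch: "real (Suc ?i choose 2) = real (?i choose 2) + real ?i"
      by (simp add: numeral_2_eq_2)
    have V: "stopped n \<Phi> (h @ [Vertex v]) = \<Phi> (Suc ?i) (?y + real ?i)" for v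
    proof (cases "Suc ?i < n")
      case True
      then show ?thesis
        by (simp add: stopped_def nvV neV ch algebra_simps)
    next
      case False
      with \<open>?i < n\<close> have n: "Suc ?i = n" by simp
      show ?thesis
        unfolding stopped_def nvV edge_count_snoc_vertex[OF n]
        using n ch by (auto simp: algebra_simps)
    qed
    have Ed: "stopped n \<Phi> (h @ [Edge e]) = \<Phi> ?i (?y - 1)" for e
      using True by (simp add: stopped_def nvE neE algebra_simps)
    have "(\<Sum>x\<in>pool N h. stopped n \<Phi> (h @ [x]))
        = (real N - real ?i) * \<Phi> (Suc ?i) (?y + real ?i) + ?y * \<Phi> ?i (?y - 1)"
      by (rule sum_pool[OF h]) (use V Ed in auto)
    also have "\<dots> = (real N - real ?i + ?y) * \<Phi> ?i ?y"
      using harm[of ?i ?y] True \<open>n \<le> N\<close> by simp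
    \<comment> \<open>Summing the constant 1 gives the pool size, which cancels the divisor in
      \<open>E\<close>.\<close>
    also have "real N - real ?i + ?y = real (card (pool N h))"
      using sum_pool[OF h, of "\<lambda>_. 1" 1 1] by simp
    finally show ?thesis
      using E pos True by (simp add: stopped_def)
  qed
qed

lemma expectation_growth:
  assumes "n \<le> N"
    and harm: "\<And>i y. i < N \<Longrightarrow>
      (real N - real i + y) * \<Phi> i y
        = (real N - real i) * \<Phi> (Suc i) (y + real i) + y * \<Phi> i (y - 1)"
  shows "measure_pmf.expectation (growth N m) (stopped n \<Phi>) = stopped n \<Phi> []"
proof (induction m)
  case 0
  then show ?case by simp
next
  case (Suc m)
  have "measure_pmf.expectation (growth N (Suc m)) (stopped n \<Phi>)
      = (\<Sum>h\<in>set_pmf (growth N m). pmf (growth N m) h *\<^sub>R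
          measure_pmf.expectation (growth_step N h) (stopped n \<Phi>))"
    unfolding growth.simps
    by (rule pmf_expectation_bind)
      (auto intro: finite_set_growth finite_set_growth_step growth_closed)
  also have "\<dots> = (\<Sum>h\<in>set_pmf (growth N m). pmf (growth N m) h *\<^sub>R stopped n \<Phi> h)"
    by (intro sum.cong refl)
      (simp add: expectation_growth_step[OF growth_closed assms])
  also have "\<dots> = measure_pmf.expectation (growth N m) (stopped n \<Phi>)"
    by (rule integral_measure_pmf[symmetric]) (auto intro: finite_set_growth)
  finally show ?case using Suc.IH by simp
qed

lemma num_vertices_growing_graph:
  assumes "h \<in> set_pmf (growing_graph N)"
  shows "num_vertices h = N"
proof -
  have c: "closed_history N h"
    using assms by (simp add: growing_graph_def growth_closed)
  have "{1..N} - {v. Vertex v \<in> set h} = {}"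
    using growing_graph_pool_empty[OF assms] unfolding pool_decomp by blast
  with card_virtual_vertices(1)[OF c] show ?thesis
    by (simp only: card.empty of_nat_0 of_nat_eq_iff right_minus_eq eq_commute[of 0])
qed

text \<open>In the complete graph all N vertices are occupied, so \<open>stopped\<close> has been
  frozen by the final time. Since n is positive, the empty history is still in the running branch,
  with no vertices and no virtual edges.\<close>

lemma expectation_virtual_edges:
  assumes "1 \<le> n" "n \<le> N"
    and harm: "\<And>i y. i < N \<Longrightarrow>
      (real N - real i + y) * \<Phi> i y
        = (real N - real i) * \<Phi> (Suc i) (y + real i) + y * \<Phi> i (y - 1)"
  shows "measure_pmf.expectation (growing_graph N)
      (\<lambda>h. \<Phi> n (real (n choose 2) - real (edge_count n h))) = \<Phi> 0 0"
proof -
  have "measure_pmf.expectation (growing_graph N)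
      (\<lambda>h. \<Phi> n (real (n choose 2) - real (edge_count n h)))
    = measure_pmf.expectation (growing_graph N) (stopped n \<Phi>)"
    by (rule integral_cong_AE)
      (use assms(2) num_vertices_growing_graph in \<open>auto simp: AE_measure_pmf_iff stopped_def\<close>)
  also have "\<dots> = stopped n \<Phi> []"
    unfolding growing_graph_def by (rule expectation_growth[OF assms(2) harm])
  also have "\<dots> = \<Phi> 0 0"
    using assms(1) by (simp add: stopped_def num_vertices_def num_edges_def numeral_2_eq_2)
  finally show ?thesis .
qed

lemma finite_set_growing_graph: "finite (set_pmf (growing_graph N))"
  by (simp add: growing_graph_def finite_set_growth)

section \<open>The two martingales and the exact variance\<close>

text \<open>This is a_i of the overview; N - i + 1 times it is the mean number of virtual edges when
  the i-th vertex arrives.\<close>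

definition mean_coeff :: "nat \<Rightarrow> nat \<Rightarrow> real" where
  "mean_coeff N i = (\<Sum>j<i. real j / (real N - real j))"


lemma mean_coeff_0 [simp]: "mean_coeff N 0 = 0"
  and mean_coeff_Suc: "mean_coeff N (Suc i) = mean_coeff N i + real i / (real N - real i)"
  by (simp_all add: mean_coeff_def)

text \<open>With W = N - i, the identity W (y / W) + y (y - 1) / (W + 1) = (W + y) y / (W + 1)
  balances the main terms. The i new edges add W (i / W), which the increment of
  \<open>mean_coeff\<close> removes.\<close>

lemma linear_martingale:
  assumes "i < N"
  defines "\<Phi> \<equiv> \<lambda>i y. y / (real N - real i + 1) - mean_coeff N i"
  shows "(real N - real i + y) * \<Phi> i y
        = (real N - real i) * \<Phi> (Suc i) (y + real i) + y * \<Phi> i (y - 1)"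
proof -
  define W where "W = real N - real i"
  have W: "W > 0" "real N - real (Suc i) + 1 = W" "real N - real i = W"
    using assms by (simp_all add: W_def)
  show ?thesis
    unfolding \<Phi>_def mean_coeff_Suc W
    using W(1) by (simp add: divide_simps) (simp add: algebra_simps)
qed

text \<open>
  Without the corrections, \<open>y (y - 1) / ((N - i + 1) (N - i + 2))\<close> drifts when a vertex joins and
  \<open>y\<close> becomes \<open>y + i\<close>: \<open>cross_coeff\<close> collects the part of the drift linear in \<open>y\<close>,
  \<open>pair_coeff\<close> the constant part.
\<close>

definition cross_coeff :: "nat \<Rightarrow> nat \<Rightarrow> real" where
  "cross_coeff N i = (\<Sum>j<i. 2 * real j / (real N - real j + 1))"

definition pair_coeff :: "nat \<Rightarrow> nat \<Rightarrow> real" where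
  "pair_coeff N i = (\<Sum>j<i. 2 * real j * mean_coeff N j / (real N - real j + 1)
      + real j * (real j - 1) / ((real N - real j) * (real N - real j + 1)))"

text \<open>With W = N - i and a = \<open>mean_coeff N i\<close>, the linear martingale becomes y /
  W - a when a vertex joins. Multiplied by the increment 2 i / (W + 1) of
  \<open>cross_coeff\<close>, it cancels the drift linear in y but leaves a multiple of a; hence
  \<open>mean_coeff\<close> inside \<open>pair_coeff\<close>.\<close>

lemma quadratic_martingale:
  assumes "i < N"
  defines "\<Phi> \<equiv> \<lambda>i y. y * (y - 1) / ((real N - real i + 1) * (real N - real i + 2))
      - cross_coeff N i * (y / (real N - real i + 1) - mean_coeff N i) - pair_coeff N i"
  shows "(real N - real i + y) * \<Phi> i y
        = (real N - real i) * \<Phi> (Suc i) (y + real i) + y * \<Phi> i (y - 1)"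
proof -
  define W where "W = real N - real i"
  have W: "W > 0" "real N - real (Suc i) + 1 = W" "real N - real (Suc i) + 2 = W + 1"
     "real N - real i = W"
    using assms by (simp_all add: W_def)
  define a b c where "a = mean_coeff N i" and "b = cross_coeff N i" and "c = pair_coeff N i"
  have S: "mean_coeff N (Suc i) = a + real i / W" "cross_coeff N (Suc i) = b + 2 * real i / (W + 1)"
    "pair_coeff N (Suc i) = c + (2 * real i * a / (W + 1) + real i * (real i - 1) / (W * (W + 1)))"
    by (simp_all add: mean_coeff_Suc cross_coeff_def pair_coeff_def a_def b_def c_def W_def)
  have nz: "W \<noteq> 0" "W + 1 \<noteq> 0" "W + 2 \<noteq> 0" using W(1) by auto
  show ?thesis
    unfolding \<Phi>_def S W a_def[symmetric] b_def[symmetric] c_def[symmetric]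
    using nz by (simp add: divide_simps) algebra
qed

text \<open>The left side is the variance divided by (N - n + 1) (N - n + 2). It turns into a sum of
  nonnegative terms, so the later estimates face no cancellation.\<close>

lemma pair_coeff_eq:
  assumes "n \<le> N"
  shows "pair_coeff N n + mean_coeff N n / (real N - real n + 2)
      - (mean_coeff N n)\<^sup>2 * (real N - real n + 1) / (real N - real n + 2)
    = (\<Sum>m<n. ((mean_coeff N m)\<^sup>2 + mean_coeff N m)
        / ((real N - real m + 1) * (real N - real m + 2)))"
  using assms
proof (induction n)
  case 0
  then show ?case by (simp add: pair_coeff_def)
next
  case (Suc n)
  define W where "W = real N - real n"
  have W: "W > 0" "real N - real (Suc n) + 1 = W" "real N - real (Suc n) + 2 = W + 1"
     "real N - real n = W"
    using Suc.prems by (simp_all add: W_def)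
  define a c where "a = mean_coeff N n" and "c = pair_coeff N n"
  have S: "mean_coeff N (Suc n) = a + real n / W"
    "pair_coeff N (Suc n) = c + (2 * real n * a / (W + 1) + real n * (real n - 1) / (W * (W + 1)))"
    by (simp_all add: mean_coeff_Suc pair_coeff_def a_def c_def W_def)
  have nz: "W \<noteq> 0" "W + 1 \<noteq> 0" "W + 2 \<noteq> 0" using W(1) by auto
  have IH: "(\<Sum>m<n. ((mean_coeff N m)\<^sup>2 + mean_coeff N m)
        / ((real N - real m + 1) * (real N - real m + 2))) = c + a / (W + 2) - a\<^sup>2 * (W + 1) / (W + 2)"
    using Suc by (simp add: W_def a_def c_def)
  show ?case
    unfolding sum.lessThan_Suc IH S W a_def[symmetric]
    using nz by (simp add: divide_simps) algebra
qed

lemma sigma2_eq: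
  assumes "1 \<le> n" "n \<le> N"
  shows "sigma2 N n = (real N - real n + 1) * (real N - real n + 2) *
    (\<Sum>m<n. ((mean_coeff N m)\<^sup>2 + mean_coeff N m)
        / ((real N - real m + 1) * (real N - real m + 2)))"
proof -
  let ?E = "measure_pmf.expectation (growing_graph N)"
  define Y where "Y h = real (n choose 2) - real (edge_count n h)" for h
  define W where "W = real N - real n"
  have W: "W \<ge> 0" using assms by (simp add: W_def)
  have int: "integrable (growing_graph N) f" for f :: "_ \<Rightarrow> real"
    by (rule integrable_measure_pmf_finite[OF finite_set_growing_graph])
  have "?E (\<lambda>h. Y h / (W + 1) - mean_coeff N n) = 0"
    using expectation_virtual_edges[OF assms linear_martingale]
    by (simp add: Y_def W_def)
  then have m1: "?E Y = (W + 1) * mean_coeff N n"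
    using W by (simp add: int field_simps)
  have "?E (\<lambda>h. Y h * (Y h - 1) / ((W + 1) * (W + 2))
      - cross_coeff N n * (Y h / (W + 1) - mean_coeff N n) - pair_coeff N n) = 0"
    using expectation_virtual_edges[OF assms quadratic_martingale]
    by (simp add: Y_def W_def cross_coeff_def pair_coeff_def)
  then have "?E (\<lambda>h. Y h * (Y h - 1)) / ((W + 1) * (W + 2))
      - cross_coeff N n * (?E Y / (W + 1) - mean_coeff N n) - pair_coeff N n = 0"
    by (simp add: int)
  \<comment> \<open>By \<open>m1\<close> the bracket multiplied by \<open>cross_coeff\<close>
    vanishes, so only \<open>pair_coeff\<close> survives.\<close>
  then have m2: "?E (\<lambda>h. Y h * (Y h - 1)) = (W + 1) * (W + 2) * pair_coeff N n"
    using W by (simp add: m1 divide_eq_eq)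
  have "sigma2 N n = ?E (\<lambda>h. (Y h - ?E Y)\<^sup>2)"
  proof -
    have "?E Y = real (n choose 2) - ?E (\<lambda>h. real (edge_count n h))"
      unfolding Y_def by (simp add: int)
    then have "Y h - ?E Y = - (real (edge_count n h) - ?E (\<lambda>h. real (edge_count n h)))" for h
      by (simp add: Y_def)
    then show ?thesis
      by (simp only: sigma2_def power2_minus)
  qed
  also have "\<dots> = ?E (\<lambda>h. (Y h)\<^sup>2) - (?E Y)\<^sup>2"
    by (rule measure_pmf.variance_eq) (auto intro: int)
  also have "?E (\<lambda>h. (Y h)\<^sup>2) = ?E (\<lambda>h. Y h * (Y h - 1) + Y h)"
    by (simp add: power2_eq_square algebra_simps)
  also have "\<dots> = ?E (\<lambda>h. Y h * (Y h - 1)) + ?E Y"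
    by (rule Bochner_Integration.integral_add) (auto intro: int)
  finally have "sigma2 N n = (W + 1) * (W + 2) * pair_coeff N n + (W + 1) * mean_coeff N n
      - ((W + 1) * mean_coeff N n)\<^sup>2"
    by (simp only: m1 m2)
  also have "\<dots> = (W + 1) * (W + 2) * (pair_coeff N n + mean_coeff N n / (W + 2)
      - (mean_coeff N n)\<^sup>2 * (W + 1) / (W + 2))"
    using W by (simp add: divide_simps) algebra
  finally show ?thesis
    unfolding W_def pair_coeff_eq[OF assms(2)] .
qed

section \<open>Asymptotics of the exact variance\<close>

text \<open>
  The limit of \<open>mean_coeff N m / N\<close> for \<open>m / N\<close> tending to \<open>s\<close>; the sum defining
  \<open>mean_coeff N m / N\<close> is a Riemann sum of \<open>s / (1 - s)\<close>.
\<close>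

definition mean_limit :: "real \<Rightarrow> real" where
  "mean_limit s = - ln (1 - s) - s"

lemma mean_limit_0 [simp]: "mean_limit 0 = 0"
  by (simp add: mean_limit_def)

lemma mean_limit_mono:
  assumes "0 \<le> s" "s \<le> t" "t < 1"
  shows "mean_limit s \<le> mean_limit t"
proof -
  have "ln ((1 - t) / (1 - s)) \<le> (1 - t) / (1 - s) - 1"
    by (rule ln_le_minus_one) (use assms in simp)
  also have "\<dots> = (s - t) / (1 - s)"
    using assms by (simp add: field_simps)
  also have "\<dots> \<le> s - t"
    using assms mult_nonpos_nonneg[of "s - t" s]
    by (subst pos_divide_le_eq) (auto simp: algebra_simps)
  finally show ?thesis
    using assms by (simp add: mean_limit_def ln_div)
qed

lemma mean_limit_nonneg: "0 \<le> s \<Longrightarrow> s < 1 \<Longrightarrow> 0 \<le> mean_limit s"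
  using mean_limit_mono[of 0 s] by simp

section \<open>The limit function as an integral, and its Riemann sums\<close>

text \<open>The limit of the summand in \<open>sigma2_eq\<close> as m / N tends to s < 1.\<close>

definition psi_density :: "real \<Rightarrow> real" where
  "psi_density s = (mean_limit s / (1 - s))\<^sup>2"

lemma psi_density_nonneg: "0 \<le> psi_density s"
  by (simp add: psi_density_def)

lemma psi_density_mono:
  assumes "0 \<le> s" "s \<le> t" "t < 1"
  shows "psi_density s \<le> psi_density t"
  unfolding psi_density_def
  by (intro power_mono frac_le divide_nonneg_nonneg)
    (use assms mean_limit_mono[of s t] mean_limit_nonneg[of s] mean_limit_nonneg[of t] in auto)

text \<open>The integral of \<open>psi_density\<close> over [0, t] in closed form. Working with this
  antiderivative and the mean value theorem avoids integrals altogether.\<close>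

definition psi_quot :: "real \<Rightarrow> real" where
  "psi_quot t = ((2 - t) * (ln (1 - t))\<^sup>2 + 2 * (3 - t) * ln (1 - t) + t * (6 - t)) / (1 - t)"

lemma psi_quot_0 [simp]: "psi_quot 0 = 0"
  by (simp add: psi_quot_def)

lemma psi_eq: "t < 1 \<Longrightarrow> psi t = (1 - t)\<^sup>2 * psi_quot t"
  by (simp add: psi_def psi_quot_def Let_def power2_eq_square)

lemma psi_quot_deriv:
  assumes "t < 1"
  shows "(psi_quot has_real_derivative psi_density t) (at t)"
proof -
  define L where "L = ln (1 - t)"
  define v where "v = 1 - t"
  have v: "v \<noteq> 0" "t = 1 - v" using assms by (simp_all add: v_def)
  have "((\<lambda>x. (2 - x) * (ln (1 - x))\<^sup>2 + 2 * (3 - x) * ln (1 - x) + x * (6 - x))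
    has_real_derivative
      (- L\<^sup>2 - (2 - t) * (2 * L / v) - 2 * L - 2 * (3 - t) / v + 6 - 2 * t)) (at t)"
    using assms
    by (auto intro!: derivative_eq_intros simp: L_def v_def divide_simps) (simp add: algebra_simps)
  then have "(psi_quot has_real_derivative
      ((- L\<^sup>2 - (2 - t) * (2 * L / v) - 2 * L - 2 * (3 - t) / v + 6 - 2 * t) * v
        + ((2 - t) * L\<^sup>2 + 2 * (3 - t) * L + t * (6 - t))) / (v * v)) (at t)"
    unfolding psi_quot_def using assms
    by (auto intro!: derivative_eq_intros simp: L_def v_def)
  also have "((- L\<^sup>2 - (2 - t) * (2 * L / v) - 2 * L - 2 * (3 - t) / v + 6 - 2 * t) * v
        + ((2 - t) * L\<^sup>2 + 2 * (3 - t) * L + t * (6 - t))) / (v * v) = ((- L - t) / v)\<^sup>2"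
    unfolding v(2) using v(1) by (simp add: divide_simps) algebra
  finally show ?thesis
    by (simp add: psi_density_def mean_limit_def L_def v_def)
qed

lemma psi_quot_increment:
  assumes "0 \<le> s" "s \<le> t" "t < 1"
  shows "psi_density s * (t - s) \<le> psi_quot t - psi_quot s"
    and "psi_quot t - psi_quot s \<le> psi_density t * (t - s)"
proof -
  have "psi_density s * (t - s) \<le> psi_quot t - psi_quot s \<and>
      psi_quot t - psi_quot s \<le> psi_density t * (t - s)"
  proof (cases "s = t")
    case False
    then have "s < t" using assms by simp
    then obtain z where z: "s < z" "z < t" "psi_quot t - psi_quot s = (t - s) * psi_density z"
      using MVT2[of s t psi_quot psi_density] psi_quot_deriv assms by fastforce
    have "psi_density s \<le> psi_density z" "psi_density z \<le> psi_density t"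
      using psi_density_mono z assms by auto
    then show ?thesis
      using \<open>s < t\<close> unfolding z(3) by (simp add: mult.commute mult_right_mono)
  qed simp
  then show "psi_density s * (t - s) \<le> psi_quot t - psi_quot s"
    and "psi_quot t - psi_quot s \<le> psi_density t * (t - s)" by auto
qed

text \<open>The density increases, so left sums lie below the integral and right sums above it. The
  upper bound is the right sum, written as the left sum plus the last term; the term at 0
  vanishes.\<close>

lemma riemann_sum_psi_density:
  assumes "n < N"
  shows "(\<Sum>m<n. psi_density (real m / real N)) / real N \<le> psi_quot (real n / real N)"
    and "psi_quot (real n / real N)
      \<le> (\<Sum>m<n. psi_density (real m / real N)) / real N + psi_density (real n / real N) / real N"
proof -
  have "(\<Sum>m<n. psi_density (real m / real N)) / real N \<le> psi_quot (real n / real N) \<and>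
     psi_quot (real n / real N)
      \<le> (\<Sum>m<n. psi_density (real m / real N)) / real N + psi_density (real n / real N) / real N"
    using assms
  proof (induction n)
    case 0
    then show ?case by (simp add: psi_density_nonneg)
  next
    case (Suc n)
    have d: "real (Suc n) / real N - real n / real N = 1 / real N"
      by (simp add: diff_divide_distrib[symmetric])
    have "real n / real N \<le> real (Suc n) / real N" "real (Suc n) / real N < 1"
      using Suc.prems by (simp_all add: divide_right_mono)
    from psi_quot_increment[OF _ this, unfolded d] Suc
    show ?case by (simp add: add_divide_distrib)
  qed
  then show "(\<Sum>m<n. psi_density (real m / real N)) / real N \<le> psi_quot (real n / real N)"
    and "psi_quot (real n / real N)
      \<le> (\<Sum>m<n. psi_density (real m / real N)) / real N + psi_density (real n / real N) / real N"
    by auto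
qed

section \<open>Error bounds away from t = 1\<close>

lemma mean_coeff_nonneg: "m \<le> N \<Longrightarrow> 0 \<le> mean_coeff N m"
  unfolding mean_coeff_def by (intro sum_nonneg) auto

text \<open>With w = N - m, one step changes the error by ln w - ln (w - 1) - 1 / w, which lies
  between 0 and 1 / (w - 1) - 1 / w. The upper bounds telescope, so the induction carries 1 / (N -
  m) - 1 / N.\<close>

lemma mean_coeff_approx:
  assumes "m < N"
  shows "mean_coeff N m / real N \<le> mean_limit (real m / real N)"
    and "mean_limit (real m / real N) \<le> mean_coeff N m / real N + 1 / (real N - real m)"
proof -
  have "0 \<le> mean_limit (real m / real N) - mean_coeff N m / real N \<and>
    mean_limit (real m / real N) - mean_coeff N m / real N \<le> 1 / (real N - real m) - 1 / real N"
    using assms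
  proof (induction m)
    case 0
    then show ?case by simp
  next
    case (Suc m)
    define w where "w = real N - real m"
    have w: "w > 1" "real m = real N - w" "real (Suc m) = real N - (w - 1)"
      using Suc.prems by (simp_all add: w_def)
    have N: "real N > 0" using Suc.prems by simp
    have "ln (w / (w - 1)) \<le> w / (w - 1) - 1"
      by (rule ln_le_minus_one) (use w in simp)
    also have "\<dots> = 1 / (w - 1)"
      using w by (simp add: field_simps)
    finally have u: "ln w - ln (w - 1) \<le> 1 / (w - 1)"
      using w by (simp add: ln_div)
    have "ln ((w - 1) / w) \<le> (w - 1) / w - 1"
      by (rule ln_le_minus_one) (use w in simp)
    also have "\<dots> = - (1 / w)"
      using w by (simp add: field_simps)
    finally have l: "1 / w \<le> ln w - ln (w - 1)"
      using w by (simp add: ln_div)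
    have p1: "mean_limit (real m / real N) = ln N - ln w - 1 + w / N"
      using w(1) N unfolding w(2) mean_limit_def by (simp add: diff_divide_distrib ln_div)
    have "real (Suc m) / real N = 1 - (w - 1) / N"
      unfolding w(3) using N by (simp add: field_simps)
    moreover have "ln ((w - 1) / N) = ln (w - 1) - ln N"
      using w(1) N by (simp add: ln_div)
    ultimately have p2: "mean_limit (real (Suc m) / real N) = ln N - ln (w - 1) - 1 + (w - 1) / N"
      by (simp add: mean_limit_def)
    have "mean_coeff N (Suc m) / N = mean_coeff N m / N + (real m / w) / N"
      by (simp add: mean_coeff_Suc w_def add_divide_distrib)
    also have "(real m / w) / N = 1 / w - 1 / N"
      unfolding w(2) using w(1) N by (simp add: field_simps)
    finally have step: "mean_limit (real (Suc m) / real N) - mean_coeff N (Suc m) / real N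
       = mean_limit (real m / real N) - mean_coeff N m / N + (ln w - ln (w - 1) - 1 / w)"
      unfolding p1 p2 by (simp add: diff_divide_distrib)
    have r: "real N - real (Suc m) = w - 1"
      by (simp add: w_def)
    have "0 \<le> mean_limit (real m / real N) - mean_coeff N m / N"
      "mean_limit (real m / real N) - mean_coeff N m / N \<le> 1 / w - 1 / N"
      using Suc by (simp_all add: w_def)
    with u l show ?case
      unfolding step r by linarith
  qed
  moreover have "0 \<le> 1 / real N" by simp
  ultimately show "mean_coeff N m / real N \<le> mean_limit (real m / real N)"
    and "mean_limit (real m / real N) \<le> mean_coeff N m / real N + 1 / (real N - real m)"
    by linarith+
qed

text \<open>In this range N - m is at least \<delta> N, so every negative power of N - m becomes one
  of N, with constants depending only on \<delta>.\<close>

lemma summand_approx: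
  assumes "0 < \<delta>" "m < N" "real m / real N \<le> 1 - \<delta>"
  defines "B \<equiv> mean_limit (1 - \<delta>)"
  shows "\<bar>((mean_coeff N m)\<^sup>2 + mean_coeff N m) / ((real N - real m + 1) * (real N - real m + 2))
      - psi_density (real m / real N)\<bar> \<le> (2 * B + 3 * B\<^sup>2 + B * \<delta>) / \<delta> ^ 3 / real N"
proof -
  define M w p b where "M = real N" and "w = real N - real m" and "p = mean_limit (real m / real N)"
    and "b = mean_coeff N m / real N"
  have M: "M > 0" and w: "w > 0" using assms by (simp_all add: M_def w_def)
  have wd: "w \<ge> \<delta> * M"
    using assms(3) M by (simp add: w_def M_def field_simps)
  have pB: "p \<le> B"
    unfolding p_def B_def by (rule mean_limit_mono) (use assms in auto)
  have b0: "0 \<le> b" using assms(2) mean_coeff_nonneg[of m N] by (simp add: b_def)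
  have bp: "b \<le> p" "p \<le> b + 1 / w"
    using mean_coeff_approx[OF assms(2)] by (simp_all add: b_def p_def w_def)
  have B0: "0 \<le> B" using pB b0 bp by linarith
  have mc: "mean_coeff N m = M * b"
    using M by (simp add: b_def M_def)
  have dens: "psi_density (real m / real N) = M\<^sup>2 * p\<^sup>2 / w\<^sup>2"
  proof -
    have e: "1 - real m / real N = w / M"
      using M by (simp add: w_def M_def field_simps)
    show ?thesis
      unfolding psi_density_def e p_def by (simp add: power_divide power_mult_distrib mult.commute)
  qed
  define P where "P = (M\<^sup>2 * b\<^sup>2 + M * b) / ((w + 1) * (w + 2))"
  \<comment> \<open>Since b \<le> p and the denominator is at least \<open>w\<^sup>2\<close>, only
    the lower order term M b can make P too large.\<close>
  have "P - M\<^sup>2 * p\<^sup>2 / w\<^sup>2 \<le> B / \<delta>\<^sup>2 / M"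
  proof -
    have "P \<le> (M\<^sup>2 * p\<^sup>2 + M * B) / w\<^sup>2"
      unfolding P_def
      by (intro frac_le add_mono mult_left_mono power_mono)
        (use M w b0 bp pB B0 in \<open>auto simp: power2_eq_square intro!: mult_mono\<close>)
    then have "P - M\<^sup>2 * p\<^sup>2 / w\<^sup>2 \<le> M * B / w\<^sup>2"
      by (simp add: add_divide_distrib)
    also have "\<dots> \<le> M * B / (\<delta> * M)\<^sup>2"
      by (intro divide_left_mono power_mono mult_nonneg_nonneg)
        (use assms(1) wd M w B0 in auto)
    also have "\<dots> = B / \<delta>\<^sup>2 / M"
      using M assms(1) by (simp add: power2_eq_square)
    finally show ?thesis .
  qed
  \<comment> \<open>P falls short in two ways: p - b \<le> 1 / w, and the denominator is shifted,
    which costs 3 / w^3.\<close>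
  moreover have "M\<^sup>2 * p\<^sup>2 / w\<^sup>2 - P \<le> (2 * B + 3 * B\<^sup>2) / \<delta> ^ 3 / M"
  proof -
    have "p\<^sup>2 - b\<^sup>2 = (p + b) * (p - b)"
      by (simp add: power2_eq_square algebra_simps)
    also have "\<dots> \<le> (2 * B) * (1 / w)"
      by (intro mult_mono) (use bp b0 pB B0 in auto)
    finally have s1: "p\<^sup>2 - b\<^sup>2 \<le> 2 * B / w" by simp
    have "1 / w\<^sup>2 - 1 / ((w + 1) * (w + 2)) = (3 * w + 2) / (w\<^sup>2 * (w + 1) * (w + 2))"
      using w by (simp add: divide_simps) (simp add: power2_eq_square algebra_simps)
    also have "\<dots> \<le> 3 / w ^ 3"
      using w by (simp add: divide_simps) (simp add: power2_eq_square power3_eq_cube algebra_simps)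
    finally have s2: "1 / w\<^sup>2 - 1 / ((w + 1) * (w + 2)) \<le> 3 / w ^ 3" .
    have s0: "1 / ((w + 1) * (w + 2)) \<le> 1 / w\<^sup>2"
      unfolding power2_eq_square by (intro frac_le mult_mono) (use w in auto)
    have "M\<^sup>2 * b\<^sup>2 / ((w + 1) * (w + 2)) \<le> P"
      unfolding P_def by (intro divide_right_mono) (use M b0 w in auto)
    then have "M\<^sup>2 * p\<^sup>2 / w\<^sup>2 - P \<le> M\<^sup>2 * p\<^sup>2 / w\<^sup>2 - M\<^sup>2 * b\<^sup>2 / ((w + 1) * (w + 2))"
      by simp
    also have "\<dots> = M\<^sup>2 * ((p\<^sup>2 - b\<^sup>2) / w\<^sup>2 + b\<^sup>2 * (1 / w\<^sup>2 - 1 / ((w + 1) * (w + 2))))"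
      by (simp add: algebra_simps diff_divide_distrib)
    also have "\<dots> \<le> M\<^sup>2 * ((2 * B / w) / w\<^sup>2 + B\<^sup>2 * (3 / w ^ 3))"
      by (intro mult_left_mono add_mono divide_right_mono s1 mult_mono s2 power_mono)
        (use bp b0 pB B0 w s0 in auto)
    also have "\<dots> = M\<^sup>2 * (2 * B + 3 * B\<^sup>2) / w ^ 3"
      by (simp add: power2_eq_square power3_eq_cube add_divide_distrib algebra_simps)
    also have "\<dots> \<le> M\<^sup>2 * (2 * B + 3 * B\<^sup>2) / (\<delta> * M) ^ 3"
      by (intro divide_left_mono power_mono mult_nonneg_nonneg)
        (use assms(1) wd M w B0 in auto)
    also have "\<dots> = (2 * B + 3 * B\<^sup>2) / \<delta> ^ 3 / M"
      using M assms(1) by (simp add: power2_eq_square power3_eq_cube)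
    finally show ?thesis .
  qed
  moreover have "(2 * B + 3 * B\<^sup>2 + B * \<delta>) / \<delta> ^ 3 / M
      = (2 * B + 3 * B\<^sup>2) / \<delta> ^ 3 / M + B / \<delta>\<^sup>2 / M"
    using assms(1) M by (simp add: add_divide_distrib power2_eq_square power3_eq_cube)
  moreover have "0 \<le> B / \<delta>\<^sup>2 / M" "0 \<le> (2 * B + 3 * B\<^sup>2) / \<delta> ^ 3 / M"
    using B0 assms(1) M by simp_all
  ultimately have "\<bar>P - M\<^sup>2 * p\<^sup>2 / w\<^sup>2\<bar> \<le> (2 * B + 3 * B\<^sup>2 + B * \<delta>) / \<delta> ^ 3 / M"
    by linarith
  then show ?thesis
    unfolding dens mc P_def by (simp add: power_mult_distrib M_def w_def)
qed

lemma bulk_error: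
  assumes "0 < \<delta>" "\<delta> < 1"
  obtains K where "\<And>N n. 1 \<le> n \<Longrightarrow> n \<le> N \<Longrightarrow> real n / real N < 1 - \<delta> \<Longrightarrow>
    \<bar>sigma2 N n / real N ^ 3 - psi (real n / real N)\<bar> \<le> K / real N"
proof -
  \<comment> \<open>\<open>K1\<close> controls the error per summand, \<open>K2\<close> the Riemann
    sum error, and \<open>K3\<close> the size of \<open>psi_quot\<close> on the range.\<close>
  define K1 where "K1 = (2 * mean_limit (1 - \<delta>) + 3 * (mean_limit (1 - \<delta>))\<^sup>2
    + mean_limit (1 - \<delta>) * \<delta>) / \<delta> ^ 3"
  define K2 where "K2 = psi_density (1 - \<delta>)"
  define K3 where "K3 = psi_quot (1 - \<delta>)"
  have K1: "K1 \<ge> 0"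
    unfolding K1_def using assms mean_limit_nonneg[of "1 - \<delta>"] by simp
  have K2: "K2 \<ge> 0"
    by (simp add: K2_def psi_density_nonneg)
  have "\<bar>sigma2 N n / real N ^ 3 - psi (real n / real N)\<bar>
      \<le> (5 * (K1 + K2 + K3) + (K1 + K2)) / real N"
    if n: "1 \<le> n" "n \<le> N" "real n / real N < 1 - \<delta>" for N n
  proof -
    define M t W where "M = real N" and "t = real n / real N" and "W = real N - real n"
    define P where "P m = ((mean_coeff N m)\<^sup>2 + mean_coeff N m)
      / ((real N - real m + 1) * (real N - real m + 2))" for m
    define S where "S = (\<Sum>m<n. P m) / M"
    define D where "D = (\<Sum>m<n. psi_density (real m / real N)) / M"
    have M: "M \<ge> 1" using n by (simp add: M_def)
    have nN: "n < N"
    proof -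
      have "real n / real N < 1" using n assms by linarith
      then show ?thesis using M by (simp add: M_def divide_less_eq_1)
    qed
    have W: "0 \<le> W" "W \<le> M" using n by (simp_all add: W_def M_def)
    have t: "0 \<le> t" "t < 1 - \<delta>" "t < 1" "1 - t = W / M"
      using n nN assms M by (simp_all add: t_def W_def M_def field_simps)
    have each: "\<bar>P m - psi_density (real m / real N)\<bar> \<le> K1 / M" if "m < n" for m
    proof -
      have "real m / real N \<le> real n / real N"
        using that by (simp add: divide_right_mono)
      then show ?thesis
        using summand_approx[of \<delta> m N] that nN n(3) assms(1)
        by (simp add: P_def K1_def M_def)
    qed
    have "\<bar>S - D\<bar> = \<bar>\<Sum>m<n. P m - psi_density (real m / real N)\<bar> / M"
      using M by (simp add: S_def D_def sum_subtractf diff_divide_distrib[symmetric])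
    also have "\<dots> \<le> (\<Sum>m<n. K1 / M) / M"
      using M each by (intro divide_right_mono order_trans[OF sum_abs] sum_mono) auto
    also have "\<dots> = K1 * (real n / M) / M" by simp
    also have "\<dots> \<le> K1 * 1 / M"
      using M K1 nN by (intro divide_right_mono mult_left_mono) (auto simp: M_def)
    finally have SD: "\<bar>S - D\<bar> \<le> K1 / M" by simp
    have "psi_density t / M \<le> K2 / M"
      unfolding K2_def using M t assms by (intro divide_right_mono psi_density_mono) auto
    then have DF: "\<bar>D - psi_quot t\<bar> \<le> K2 / M"
      using riemann_sum_psi_density[OF nN] K2 M by (simp add: D_def t_def M_def)
    have SF: "\<bar>S - psi_quot t\<bar> \<le> (K1 + K2) / M"
      using SD DF by (simp add: add_divide_distrib)
    have "psi_quot t \<le> K3"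
    proof -
      have "0 \<le> psi_density t * (1 - \<delta> - t)"
        using t psi_density_nonneg[of t] by simp
      also have "\<dots> \<le> K3 - psi_quot t"
        unfolding K3_def by (rule psi_quot_increment) (use t assms in auto)
      finally show ?thesis by simp
    qed
    moreover have "(K1 + K2) / M \<le> K1 + K2"
      using M K1 K2 by (simp add: divide_le_eq mult_le_cancel_left1)
    ultimately have SK: "S \<le> K1 + K2 + K3" using SF by linarith
    have S0: "0 \<le> S"
      unfolding S_def P_def
      using M n mean_coeff_nonneg[of _ N] by (intro divide_nonneg_nonneg sum_nonneg) auto
    have "sigma2 N n / real N ^ 3 = (W + 1) * (W + 2) / M\<^sup>2 * S"
      using sigma2_eq[OF n(1,2)] M
      by (simp add: S_def P_def W_def M_def power2_eq_square power3_eq_cube)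
    \<comment> \<open>The excess of (W + 1) (W + 2) over W^2 is 3 W + 2 \<le> 5 M, the source of the
      factor 5 in the constant.\<close>
    also have "\<dots> = (W / M)\<^sup>2 * S + (3 * W + 2) / M\<^sup>2 * S"
      using M by (simp add: field_simps power2_eq_square)
    finally have "sigma2 N n / real N ^ 3 - psi (real n / real N)
        = (W / M)\<^sup>2 * (S - psi_quot t) + (3 * W + 2) / M\<^sup>2 * S"
      using psi_eq[OF t(3)] unfolding t(4) by (simp add: t_def[symmetric] algebra_simps)
    also have "\<bar>\<dots>\<bar> \<le> (W / M)\<^sup>2 * \<bar>S - psi_quot t\<bar> + (3 * W + 2) / M\<^sup>2 * S"
      using W S0 M by (intro order_trans[OF abs_triangle_ineq]) (simp add: abs_mult)
    also have "\<dots> \<le> 1 * ((K1 + K2) / M) + 5 / M * (K1 + K2 + K3)"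
    proof (intro add_mono mult_mono SF SK)
      show "(W / M)\<^sup>2 \<le> 1"
        using W M by (simp add: power_le_one)
      show "(3 * W + 2) / M\<^sup>2 \<le> 5 / M"
        using W M by (simp add: divide_simps power2_eq_square)
    qed (use M S0 in auto)
    also have "\<dots> = (5 * (K1 + K2 + K3) + (K1 + K2)) / M"
      by (simp add: add_divide_distrib)
    finally show ?thesis by (simp add: M_def)
  qed
  then show ?thesis by (rule that)
qed

section \<open>Smallness near t = 1 and uniform convergence\<close>

lemma sum_inverse_telescope:
  assumes "n \<le> N"
  shows "(\<Sum>m<n. 1 / ((real N - real m + 1) * (real N - real m + 2)))
    = 1 / (real N - real n + 2) - 1 / (real N + 2)"
  using assms
proof (induction n)
  case (Suc n)
  define w where "w = real N - real n"
  have w: "w \<ge> 1" "real N - real (Suc n) + 2 = w + 1" "real N - real n = w"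
    using Suc.prems by (simp_all add: w_def)
  have "1 / (w + 2) + 1 / ((w + 1) * (w + 2)) = 1 / (w + 1)"
    using w(1) by (simp add: divide_simps)
  with Suc show ?case by (simp add: w)
qed simp

text \<open>For m < n, 1 - m / N is at least x, so every \<open>mean_coeff N m\<close> is at most -
  N ln x. The shift by one keeps x positive at n = N. The telescoping sum then cancels the factor N
  - n + 2, and N - n + 1 = x N.\<close>

lemma sigma2_upper:
  assumes "1 \<le> n" "n \<le> N"
  defines "x \<equiv> (real N - real n + 1) / real N"
  shows "0 \<le> sigma2 N n" "sigma2 N n / real N ^ 3 \<le> x * ((ln x)\<^sup>2 - ln x)"
proof -
  show "0 \<le> sigma2 N n"
    unfolding sigma2_def by (rule measure_pmf.variance_positive)
  define M W l where "M = real N" and "W = real N - real n" and "l = - ln x"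
  have M: "M \<ge> 1" and W: "W \<ge> 0" "W + 1 \<le> M"
    using assms by (simp_all add: M_def W_def)
  have x: "0 < x" "x \<le> 1" "x = (W + 1) / M"
    using assms M W by (simp_all add: x_def W_def M_def)
  have l: "l \<ge> 0" using x by (simp add: l_def)
  have mc: "(mean_coeff N m)\<^sup>2 + mean_coeff N m \<le> M\<^sup>2 * (l\<^sup>2 + l)" if "m < n" for m
  proof -
    have mN: "m < N" using that assms by simp
    have "mean_coeff N m / M \<le> mean_limit (real m / real N)"
      using mean_coeff_approx(1)[OF mN] by (simp add: M_def)
    also have "\<dots> \<le> - ln (1 - real m / real N)" by (simp add: mean_limit_def)
    also have "\<dots> \<le> l"
    proof -
      have "real n \<ge> real m + 1" using that by simp
      then have "x \<le> (real N - real m) / real N"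
        unfolding x_def by (intro divide_right_mono) auto
      also have "\<dots> = 1 - real m / real N"
        using mN by (simp add: field_simps)
      finally have "x \<le> 1 - real m / real N" .
      then show ?thesis using x by (simp add: l_def)
    qed
    finally have "mean_coeff N m \<le> M * l"
      using M by (simp add: field_simps)
    moreover have "0 \<le> mean_coeff N m"
      using mN by (simp add: mean_coeff_nonneg)
    ultimately have "(mean_coeff N m)\<^sup>2 + mean_coeff N m \<le> (M * l)\<^sup>2 + M * l"
      by (intro add_mono power_mono)
    \<comment> \<open>M \<ge> 1 absorbs the linear term M l into M^2 l.\<close>
    also have "\<dots> \<le> M\<^sup>2 * (l\<^sup>2 + l)"
      using M l mult_right_mono[of 1 M "M * l"]
      by (simp add: power2_eq_square algebra_simps)
    finally show ?thesis .
  qed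
  have "sigma2 N n = (W + 1) * (W + 2) * (\<Sum>m<n. ((mean_coeff N m)\<^sup>2 + mean_coeff N m)
        / ((real N - real m + 1) * (real N - real m + 2)))"
    using sigma2_eq[OF assms(1,2)] by (simp add: W_def)
  also have "\<dots> \<le> (W + 1) * (W + 2) * (\<Sum>m<n. M\<^sup>2 * (l\<^sup>2 + l)
        / ((real N - real m + 1) * (real N - real m + 2)))"
    by (intro mult_left_mono sum_mono divide_right_mono mc) (use W assms in auto)
  also have "\<dots> = (W + 1) * (W + 2) * (M\<^sup>2 * (l\<^sup>2 + l)
      * (\<Sum>m<n. 1 / ((real N - real m + 1) * (real N - real m + 2))))"
    by (simp add: sum_distrib_left)
  also have "\<dots> \<le> (W + 1) * (W + 2) * (M\<^sup>2 * (l\<^sup>2 + l) * (1 / (W + 2)))"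
    unfolding sum_inverse_telescope[OF assms(2)]
    by (intro mult_left_mono) (use W l in \<open>auto simp: W_def\<close>)
  also have "\<dots> = x * (l\<^sup>2 + l) * M ^ 3"
    using M W by (simp add: x(3) field_simps power2_eq_square power3_eq_cube)
  finally show "sigma2 N n / real N ^ 3 \<le> x * ((ln x)\<^sup>2 - ln x)"
    using M by (simp add: l_def M_def divide_le_eq)
qed

lemma eventually_uniform_error:
  assumes "\<epsilon> > 0"
  shows "eventually (\<lambda>N. \<forall>n\<in>{1..N}.
    \<bar>sigma2 N n / real N ^ 3 - psi (real n / real N)\<bar> < \<epsilon>) sequentially"
proof -
  have "((\<lambda>x::real. x * ((ln x)\<^sup>2 - ln x)) \<longlongrightarrow> 0) (at_right 0)"
    by real_asymp
  then have "eventually (\<lambda>x::real. x * ((ln x)\<^sup>2 - ln x) < \<epsilon> / 2) (at_right 0)"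
    using assms by (intro order_tendstoD(2)) auto
  \<comment> \<open>The expression inside the absolute value is \<open>psi (1 - x)\<close>.\<close>
  moreover have "((\<lambda>x::real. \<bar>x * ((1 + x) * (ln x)\<^sup>2 + 2 * (2 + x) * ln x + (1 - x) * (5 + x))\<bar>)
      \<longlongrightarrow> 0) (at_right 0)"
    by real_asymp
  then have "eventually (\<lambda>x::real.
      \<bar>x * ((1 + x) * (ln x)\<^sup>2 + 2 * (2 + x) * ln x + (1 - x) * (5 + x))\<bar> < \<epsilon> / 2) (at_right 0)"
    using assms by (intro order_tendstoD(2)) auto
  ultimately have "eventually (\<lambda>x::real. x * ((ln x)\<^sup>2 - ln x) < \<epsilon> / 2 \<and>
      \<bar>x * ((1 + x) * (ln x)\<^sup>2 + 2 * (2 + x) * ln x + (1 - x) * (5 + x))\<bar> < \<epsilon> / 2) (at_right 0)"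
    by (rule eventually_conj)
  then obtain d where d: "d > 0"
    and d1: "\<And>x. 0 < x \<Longrightarrow> x < d \<Longrightarrow> x * ((ln x)\<^sup>2 - ln x) < \<epsilon> / 2"
    and d2: "\<And>x. 0 < x \<Longrightarrow> x < d \<Longrightarrow>
      \<bar>x * ((1 + x) * (ln x)\<^sup>2 + 2 * (2 + x) * ln x + (1 - x) * (5 + x))\<bar> < \<epsilon> / 2"
    unfolding eventually_at_right_field by auto
  \<comment> \<open>Half of d is kept for the shift 1 / N in x; the bound 1 / 2 ensures \<delta> <
    1.\<close>
  define \<delta> where "\<delta> = min (d / 2) (1 / 2)"
  have \<delta>: "0 < \<delta>" "\<delta> < 1" "\<delta> + d / 2 \<le> d" using d by (auto simp: \<delta>_def)
  obtain K where K: "\<And>N n. 1 \<le> n \<Longrightarrow> n \<le> N \<Longrightarrow> real n / real N < 1 - \<delta> \<Longrightarrow>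
    \<bar>sigma2 N n / real N ^ 3 - psi (real n / real N)\<bar> \<le> K / real N"
    using bulk_error[OF \<delta>(1,2)] by metis
  have lim: "(\<lambda>N. K / real N) \<longlonglongrightarrow> 0" "(\<lambda>N. 1 / real N) \<longlonglongrightarrow> 0"
    by real_asymp+
  have "eventually (\<lambda>N. K / real N < \<epsilon>) sequentially"
    by (rule order_tendstoD(2)[OF lim(1) assms])
  moreover have "eventually (\<lambda>N. 1 / real N < d / 2) sequentially"
    by (rule order_tendstoD(2)[OF lim(2)]) (use d in simp)
  ultimately show ?thesis
  proof eventually_elim
    case (elim N)
    show ?case
    proof
      fix n
      assume "n \<in> {1..N}"
      then have n: "1 \<le> n" "n \<le> N" by auto
      show "\<bar>sigma2 N n / real N ^ 3 - psi (real n / real N)\<bar> < \<epsilon>"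
      proof (cases "real n / real N < 1 - \<delta>")
        case True
        with K[OF n] elim(1) show ?thesis by simp
      next
        case False
        define x where "x = (real N - real n + 1) / real N"
        have "x = 1 - real n / real N + 1 / real N"
          using n by (simp add: x_def field_simps)
        then have "x < d"
          using False elim(2) \<delta> by linarith
        moreover have "x > 0"
          using n by (simp add: x_def)
        ultimately have "x * ((ln x)\<^sup>2 - ln x) < \<epsilon> / 2"
          by (intro d1)
        with sigma2_upper(2)[OF n, folded x_def] have s: "sigma2 N n / real N ^ 3 < \<epsilon> / 2"
          by (rule le_less_trans)
        have s0: "0 \<le> sigma2 N n / real N ^ 3"
          using sigma2_upper(1)[OF n] by simp
        have "\<bar>psi (real n / real N)\<bar> < \<epsilon> / 2"
        \<comment> \<open>At n = N, \<open>psi\<close> is 0 by definition; otherwise y is positive,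
          as \<open>d2\<close> demands.\<close>
        proof (cases "n = N")
          case True
          then show ?thesis using n assms by (simp add: psi_def)
        next
          case False
          define y where "y = 1 - real n / real N"
          have "y > 0" using False n by (simp add: y_def)
          moreover have "y < d"
            using \<open>\<not> real n / real N < 1 - \<delta>\<close> \<delta> d by (simp add: y_def)
          moreover have "psi (real n / real N)
            = y * ((1 + y) * (ln y)\<^sup>2 + 2 * (2 + y) * ln y + (1 - y) * (5 + y))"
          proof -
            have e: "real n / real N = 1 - y" by (simp add: y_def)
            show ?thesis
              unfolding e using \<open>y > 0\<close> by (simp add: psi_def Let_def algebra_simps)
          qed
          ultimately show ?thesis using d2[of y] by simp
        qed
        with s s0 show ?thesis by linarith
      qed
    qed
  qed
qed

theorem mainTheorem7:
  shows "(\<lambda>N. MAX n\<in>{1..N}. \<bar>sigma2 N n / real N ^ 3 - psi (real n / real N)\<bar>) \<longlonglongrightarrow> 0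
    \<and> (\<forall>\<delta>::real. 0 < \<delta> \<and> \<delta> < 1 \<longrightarrow>
        (\<lambda>N. MAX n\<in>{n \<in> {1..N}. real n / real N < 1 - \<delta>}.
               \<bar>sigma2 N n / real N ^ 3 - psi (real n / real N)\<bar>) \<in> O(\<lambda>N. 1 / real N))"
proof (intro conjI allI impI)
  show "(\<lambda>N. MAX n\<in>{1..N}. \<bar>sigma2 N n / real N ^ 3 - psi (real n / real N)\<bar>) \<longlonglongrightarrow> 0"
  proof (rule tendstoI)
    fix \<epsilon> :: real
    assume "\<epsilon> > 0"
    from eventually_uniform_error[OF this] eventually_ge_at_top[of 1]
    show "eventually (\<lambda>N. dist (MAX n\<in>{1..N}.
        \<bar>sigma2 N n / real N ^ 3 - psi (real n / real N)\<bar>) 0 < \<epsilon>) sequentially"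
    proof eventually_elim
      case (elim N)
      let ?f = "\<lambda>n. \<bar>sigma2 N n / real N ^ 3 - psi (real n / real N)\<bar>"
      have "(MAX n\<in>{1..N}. ?f n) \<in> ?f ` {1..N}"
        using elim(2) by (intro Max_in) auto
      with elim(1) show ?case by auto
    qed
  qed
next
  fix \<delta> :: real
  assume "0 < \<delta> \<and> \<delta> < 1"
  then have \<delta>: "0 < \<delta>" "\<delta> < 1" by auto
  obtain K where K: "\<And>N n. 1 \<le> n \<Longrightarrow> n \<le> N \<Longrightarrow> real n / real N < 1 - \<delta> \<Longrightarrow>
    \<bar>sigma2 N n / real N ^ 3 - psi (real n / real N)\<bar> \<le> K / real N"
    using bulk_error[OF \<delta>] by metis
  have "(\<lambda>N. 1 / real N) \<longlonglongrightarrow> 0"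
    by real_asymp
  \<comment> \<open>This puts n = 1 into the range, so that \<open>Max\<close> is taken over a
    nonempty set and is attained.\<close>
  then have ev: "eventually (\<lambda>N. 1 / real N < 1 - \<delta>) sequentially"
    using \<delta> by (auto intro: order_tendstoD(2))
  show "(\<lambda>N. MAX n\<in>{n \<in> {1..N}. real n / real N < 1 - \<delta>}.
      \<bar>sigma2 N n / real N ^ 3 - psi (real n / real N)\<bar>) \<in> O(\<lambda>N. 1 / real N)"
  proof (rule bigoI[of _ K])
    from ev eventually_ge_at_top[of 1]
    show "eventually (\<lambda>N. norm (MAX n\<in>{n \<in> {1..N}. real n / real N < 1 - \<delta>}.
      \<bar>sigma2 N n / real N ^ 3 - psi (real n / real N)\<bar>) \<le> K * norm (1 / real N)) sequentially"
    proof eventually_elim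
      case (elim N)
      let ?f = "\<lambda>n. \<bar>sigma2 N n / real N ^ 3 - psi (real n / real N)\<bar>"
      let ?A = "{n \<in> {1..N}. real n / real N < 1 - \<delta>}"
      have "1 \<in> ?A" using elim by simp
      then have "Max (?f ` ?A) \<in> ?f ` ?A"
        by (intro Max_in) auto
      with K show ?case by auto
    qed
  qed
qed

end
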